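(* Let $E=(E^+,E^-)$ be an example set with $E^+=\{\mathcal D_i\mid i\in I^+\}$ and $E^-=\{\mathcal D_i\mid i\in I^-\}$ ($I^+,I^-$ disjoint, $I^+=\{1,\dots,l\}$), let $\Sigma$ be the set of atoms occurring in $E$, $\Sigma^\bot=\Sigma\cup\{\bot\}$, let $\mathfrak P$ be the product of the transition systems $S^i$, $i\in I^+$, and $\mathfrak N$ the disjoint union of the $S^i$, $i\in I^-$ (all defined below). Then (i) $E$ is not $\mathcal Q[\mathcal U_s]$-separable iff $\mathfrak P$ is simulated by $\mathfrak N$; (ii) $E$ is not $\mathcal Q_p[\mathcal U]$-separable iff $\mathfrak P$ is contained in $\mathfrak N$.
   Context: Strict semantics of LTL over $\mathbb N$: $\mathcal I,n\models\varphi\,\mathcal U\,\psi$ iff there is $m>n$ with $\mathcal I,m\models\psi$ and $\mathcal I,k\models\varphi$ for all $n<k<m$. A data instance is a finite set of facts $A(\ell)$, $\ell\in\mathbb N$, with maximal timestamp $\max\mathcal D$; $\mathcal D\models\varkappa(0)$ means $\mathcal I,0\models\varkappa$ in every interpretation $\mathcal I$ making all facts of $\mathcal D$ true. $\mathcal Q[\mathcal U]$: queries built from atoms, $\top,\bot$ with $\wedge$ and $\mathcal U$. $\mathcal Q[\mathcal U_s]$: $\mathcal Q[\mathcal U]$-queries with no subquery $\varkappa_1\,\mathcal U\,\varkappa_2$ where $\mathcal U$ occurs in $\varkappa_1$. $\mathcal Q_p[\mathcal U]$: queries $\rho_0\wedge(\lambda_1\,\mathcal U\,(\rho_1\wedge(\lambda_2\,\mathcal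 U\,(\dots(\lambda_n\,\mathcal U\,\rho_n)\dots))))$ with $\rho_i$ conjunctions of atoms and each $\lambda_i$ a conjunction of atoms or $\bot$. $E$ is $\mathcal Q$-separable if some $\varkappa\in\mathcal Q$ satisfies $\mathcal D\models\varkappa(0)$ for all $\mathcal D\in E^+$ and $\mathcal D\not\models\varkappa(0)$ for all $\mathcal D\in E^-$. A transition system consists of a set of states, each labelled by a subset of $\Sigma$, a set of directed transitions between states, each labelled by a subset of $\Sigma^\bot$, and a set of start states. A run is a finite path $s_0\to s_1\to\dots\to s_n$ ($n\ge0$) with $s_0$ a start state, together with its labels. The computation tree $\mathfrak T_S$ has the runs of $S$ as nodes, the runs of length $0$ as roots, and an edge from $s_0\to\dots\to s_n$ to $s_0\to\dots\to s_n\to s_{n+1}$, with node label that of the last state and edge label that of the last transition. $S$ is contained in $S'$ if for every run $r$ of $S$ there is a run $r'$ of $S'$ of the same length such that each state label and each transition label of $r$ is a subset of the corresponding label in $r'$. $S$ is simulated by $S'$ if every finite subtree of $\mathfrak T_S$ (a finite set of nodes containing a root and closed under taking prefixes) has a homomorphism into $\mathfrak T_{S'}$, i.e. a map sending the root to a root, edges to edges, and such that each node label and edge label is a subset of the label of the image. For $i\in I^+\cup I^-$ with $M_i=\max\mathcal D_i$, $S^i$ has states $0,\dots,M_i+1$ with single start state $0$; state $j\le M_i$ is labelled $\{A\mid A(j)\in\mathcal D_i\}$ and $M_i+1$ is labelled $\emptyset$; for all $0\le j<k\le M_i+1$ there is a transition $j\to k$ labelled $\{A\in\Sigma^\bot\mid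 A(n)\in\mathcal D_i\text{ for all } n \text{ with } j<n<k\}$ (so it contains $\bot$ iff $k=j+1$), and a loop $M_i+1\to M_i+1$ labelled $\Sigma^\bot$. The product $\mathfrak P$ has as states tuples $(s_1,\dots,s_l)$ of states of $S^1,\dots,S^l$, start state the tuple of start states, state labels the intersection of component labels, and a transition $(s_1,\dots,s_l)\to(p_1,\dots,p_l)$ iff $s_i\to p_i$ in $S^i$ for all $i$, labelled by the intersection of the component transition labels. $\mathfrak N$ is the disjoint union of the $S^i$, $i\in I^-$, with the union of their start states. *)

theory Defs
  imports Main "HOL-Library.FuncSet" "HOL-Library.Sublist"
begin

section \<open>Queries, data instances and separability\<close>

datatype 'a query =
    Atom 'a
  | Top
  | Bot
  | And "'a query" "'a query"
  | Until "'a query" "'a query"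

type_synonym 'a interp = "nat \<Rightarrow> 'a set"

primrec sat :: "'a interp \<Rightarrow> nat \<Rightarrow> 'a query \<Rightarrow> bool" where
  "sat I n (Atom A) \<longleftrightarrow> A \<in> I n"
| "sat I n Top \<longleftrightarrow> True"
| "sat I n Bot \<longleftrightarrow> False"
| "sat I n (And q r) \<longleftrightarrow> sat I n q \<and> sat I n r"
| "sat I n (Until q r) \<longleftrightarrow>
     (\<exists>m>n. sat I m r \<and> (\<forall>k. n < k \<and> k < m \<longrightarrow> sat I k q))"

text \<open>The pair \<open>(A, n)\<close> is the fact \<open>A(n)\<close>. Finiteness of data instances is
  assumed where they are used.\<close>

type_synonym 'a data = "('a \<times> nat) set"

text \<open>The maximal timestamp; it is 0 for the empty instance.\<close>

definition max_time :: "'a data \<Rightarrow> nat" where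
  "max_time D = Max (insert 0 (snd ` D))"

definition model :: "'a interp \<Rightarrow> 'a data \<Rightarrow> bool" where
  "model I D \<longleftrightarrow> (\<forall>(A, n)\<in>D. A \<in> I n)"

definition entails0 :: "'a data \<Rightarrow> 'a query \<Rightarrow> bool" where
  "entails0 D q \<longleftrightarrow> (\<forall>I. model I D \<longrightarrow> sat I 0 q)"

definition separable :: "'a query set \<Rightarrow> 'a data set \<Rightarrow> 'a data set \<Rightarrow> bool" where
  "separable Q Epos Eneg \<longleftrightarrow>
     (\<exists>q\<in>Q. (\<forall>D\<in>Epos. entails0 D q) \<and> (\<forall>D\<in>Eneg. \<not> entails0 D q))"

primrec subqueries :: "'a query \<Rightarrow> 'a query set" where
  "subqueries (Atom A) = {Atom A}"
| "subqueries Top = {Top}"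
| "subqueries Bot = {Bot}"
| "subqueries (And q r) = insert (And q r) (subqueries q \<union> subqueries r)"
| "subqueries (Until q r) = insert (Until q r) (subqueries q \<union> subqueries r)"

definition until_occurs :: "'a query \<Rightarrow> bool" where
  "until_occurs q \<longleftrightarrow> (\<exists>q1 q2. Until q1 q2 \<in> subqueries q)"

definition Q_Us :: "'a query set" where
  "Q_Us = {q. \<forall>q1 q2. Until q1 q2 \<in> subqueries q \<longrightarrow> \<not> until_occurs q1}"

text \<open>\<^const>\<open>Top\<close> is the empty conjunction.\<close>

inductive_set atom_conjs :: "'a query set" where
  "Top \<in> atom_conjs"
| "Atom A \<in> atom_conjs"
| "q \<in> atom_conjs \<Longrightarrow> r \<in> atom_conjs \<Longrightarrow> And q r \<in> atom_conjs"

inductive_set Q_p :: "'a query set" where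
  "\<rho> \<in> atom_conjs \<Longrightarrow> \<rho> \<in> Q_p"
| "\<rho> \<in> atom_conjs \<Longrightarrow> lam \<in> atom_conjs \<union> {Bot} \<Longrightarrow> q \<in> Q_p
     \<Longrightarrow> And \<rho> (Until lam q) \<in> Q_p"

definition atoms_of :: "'a data set \<Rightarrow> 'a set" where
  "atoms_of E = (\<Union>D\<in>E. fst ` D)"


section \<open>Transition systems\<close>

text \<open>Transition labels are sets of elements of type \<^typ>\<open>'a option\<close>, where
  \<^const>\<open>None\<close> stands for \<open>\<bottom>\<close>. The label functions are relevant only on
  states and transitions, respectively.\<close>

record ('s, 'a) tsys =
  ts_states :: "'s set"
  ts_label :: "'s \<Rightarrow> 'a set"
  ts_trans :: "('s \<times> 's) set"
  ts_tlabel :: "'s \<Rightarrow> 's \<Rightarrow> 'a option set"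
  ts_start :: "'s set"

text \<open>The run \<open>s\<^sub>0 \<rightarrow> \<dots> \<rightarrow> s\<^sub>n\<close> is the list of its \<open>n + 1\<close> states.\<close>

definition runs :: "('s, 'a) tsys \<Rightarrow> 's list set" where
  "runs S = {r. r \<noteq> [] \<and> set r \<subseteq> ts_states S \<and> hd r \<in> ts_start S \<and>
     (\<forall>k. Suc k < length r \<longrightarrow> (r ! k, r ! Suc k) \<in> ts_trans S)}"

definition contained :: "('s, 'a) tsys \<Rightarrow> ('t, 'a) tsys \<Rightarrow> bool" where
  "contained S S' \<longleftrightarrow> (\<forall>r\<in>runs S. \<exists>r'\<in>runs S'. length r' = length r \<and>
     (\<forall>k<length r. ts_label S (r ! k) \<subseteq> ts_label S' (r' ! k)) \<and>
     (\<forall>k. Suc k < length r \<longrightarrow>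
        ts_tlabel S (r ! k) (r ! Suc k) \<subseteq> ts_tlabel S' (r' ! k) (r' ! Suc k)))"

text \<open>The computation tree of \<open>S\<close> has node set \<^term>\<open>runs S\<close>.\<close>

definition tree_roots :: "('s, 'a) tsys \<Rightarrow> 's list set" where
  "tree_roots S = {r \<in> runs S. length r = 1}"

definition tree_edges :: "('s, 'a) tsys \<Rightarrow> ('s list \<times> 's list) set" where
  "tree_edges S = {(r, r @ [s]) | r s. r \<in> runs S \<and> r @ [s] \<in> runs S}"

definition node_label :: "('s, 'a) tsys \<Rightarrow> 's list \<Rightarrow> 'a set" where
  "node_label S r = ts_label S (last r)"

definition edge_label :: "('s, 'a) tsys \<Rightarrow> 's list \<Rightarrow> 's list \<Rightarrow> 'a option set" where
  "edge_label S r r' = ts_tlabel S (last r) (last r')"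

text \<open>A subtree has exactly one root, although the computation tree of a system with
  several start states is a forest.\<close>

definition finite_subtree :: "('s, 'a) tsys \<Rightarrow> 's list set \<Rightarrow> bool" where
  "finite_subtree S T \<longleftrightarrow> finite T \<and> T \<subseteq> runs S \<and> (\<exists>!r. r \<in> T \<inter> tree_roots S) \<and>
     (\<forall>r\<in>T. \<forall>p. p \<noteq> [] \<and> prefix p r \<longrightarrow> p \<in> T)"

definition tree_hom ::
    "('s, 'a) tsys \<Rightarrow> 's list set \<Rightarrow> ('t, 'a) tsys \<Rightarrow> ('s list \<Rightarrow> 't list) \<Rightarrow> bool" where
  "tree_hom S T S' h \<longleftrightarrow>
     h \<in> T \<rightarrow> runs S' \<and>
     (\<forall>r \<in> T \<inter> tree_roots S. h r \<in> tree_roots S') \<and>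
     (\<forall>r\<in>T. node_label S r \<subseteq> node_label S' (h r)) \<and>
     (\<forall>r\<in>T. \<forall>r'\<in>T. (r, r') \<in> tree_edges S \<longrightarrow>
        (h r, h r') \<in> tree_edges S' \<and> edge_label S r r' \<subseteq> edge_label S' (h r) (h r'))"

definition simulated :: "('s, 'a) tsys \<Rightarrow> ('t, 'a) tsys \<Rightarrow> bool" where
  "simulated S S' \<longleftrightarrow> (\<forall>T. finite_subtree S T \<longrightarrow> (\<exists>h. tree_hom S T S' h))"

definition with_bot :: "'a set \<Rightarrow> 'a option set" where
  "with_bot \<Sigma> = insert None (Some ` \<Sigma>)"

definition data_ts :: "'a set \<Rightarrow> 'a data \<Rightarrow> (nat, 'a) tsys" where
  "data_ts \<Sigma> D = (let M = max_time D in
     \<lparr> ts_states = {0..M + 1},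
       ts_label = (\<lambda>j. if j \<le> M then {A. (A, j) \<in> D} else {}),
       ts_trans = {(j, k). j < k \<and> k \<le> M + 1} \<union> {(M + 1, M + 1)},
       ts_tlabel = (\<lambda>j k. if j = M + 1 \<and> k = M + 1 then with_bot \<Sigma>
          else {x \<in> with_bot \<Sigma>. \<forall>n. j < n \<and> n < k \<longrightarrow> (\<exists>A. x = Some A \<and> (A, n) \<in> D)}),
       ts_start = {0} \<rparr>)"

definition ts_product ::
    "'i set \<Rightarrow> ('i \<Rightarrow> ('s, 'a) tsys) \<Rightarrow> ('i \<Rightarrow> 's, 'a) tsys" where
  "ts_product I S =
     \<lparr> ts_states = (\<Pi>\<^sub>E i\<in>I. ts_states (S i)),
       ts_label = (\<lambda>s. \<Inter>i\<in>I. ts_label (S i) (s i)),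
       ts_trans = {(s, p). s \<in> (\<Pi>\<^sub>E i\<in>I. ts_states (S i)) \<and> p \<in> (\<Pi>\<^sub>E i\<in>I. ts_states (S i)) \<and>
          (\<forall>i\<in>I. (s i, p i) \<in> ts_trans (S i))},
       ts_tlabel = (\<lambda>s p. \<Inter>i\<in>I. ts_tlabel (S i) (s i) (p i)),
       ts_start = (\<Pi>\<^sub>E i\<in>I. ts_start (S i)) \<rparr>"

definition ts_union ::
    "'i set \<Rightarrow> ('i \<Rightarrow> ('s, 'a) tsys) \<Rightarrow> ('i \<times> 's, 'a) tsys" where
  "ts_union I S =
     \<lparr> ts_states = (SIGMA i:I. ts_states (S i)),
       ts_label = (\<lambda>(i, s). ts_label (S i) s),
       ts_trans = {((i, s), (i, p)) | i s p. i \<in> I \<and> (s, p) \<in> ts_trans (S i)},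
       ts_tlabel = (\<lambda>(i, s) (_, p). ts_tlabel (S i) s p),
       ts_start = (SIGMA i:I. ts_start (S i)) \<rparr>"

end

theory Submission
  imports Defs
begin

text \<open>The states of \<open>S\<^sup>i\<close> are the time points \<open>0, \<dots>, M\<^sub>i + 1\<close> of the least model of \<open>\<D>\<^sub>i\<close>,
  the last one standing for the indistinguishable points after \<open>M\<^sub>i\<close>. A query that holds in the
  least models of all positive examples unravels into a finite tree of runs of the product: at
  each \<open>\<U>\<close> the witnesses of all examples are advanced simultaneously. Every homomorphic image of
  that tree in a negative example forces the query there. Conversely, a finite tree can be read
  off as a query, by turning state labels into conjunctions of atoms and transitions into \<open>\<U>\<close>.
  Path-shaped trees correspond to the queries in \<open>\<Q>\<^sub>p[\<U>]\<close>.\<close>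

section \<open>Least models\<close>

definition least_model :: "'a data \<Rightarrow> 'a interp" where
  "least_model D n = {A. (A, n) \<in> D}"

lemma model_least_model: "model (least_model D) D"
  by (auto simp: model_def least_model_def)

lemma sat_mono: "sat I n q \<Longrightarrow> (\<And>n. I n \<subseteq> J n) \<Longrightarrow> sat J n q"
proof (induction q arbitrary: n)
  case (Until q r)
  then obtain m where "m > n" "sat I m r" "\<forall>k. n < k \<and> k < m \<longrightarrow> sat I k q" by auto
  with Until show ?case by (auto intro!: exI[of _ m])
qed auto

text \<open>Queries contain no negation, so truth is monotone in the interpretation, and the least
  model lies below every model of the data.\<close>

lemma entails0_iff_least_model: "entails0 D q \<longleftrightarrow> sat (least_model D) 0 q"
proof
  assume "sat (least_model D) 0 q"
  then show "entails0 D q"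
    by (auto simp: entails0_def model_def least_model_def elim!: sat_mono)
qed (simp add: entails0_def model_least_model)

lemma max_time_ge: "finite D \<Longrightarrow> (A, n) \<in> D \<Longrightarrow> n \<le> max_time D"
  by (force simp: max_time_def intro: Max_ge)

lemma least_model_after: "finite D \<Longrightarrow> max_time D < n \<Longrightarrow> least_model D n = {}"
  using max_time_ge[of D _ n] by (auto simp: least_model_def)

text \<open>Every point after the maximal timestamp has an empty label and only such points ahead of
  it. For \<open>Until\<close>, the witness can therefore be moved to the immediate successor, which
  leaves no intermediate points to check.\<close>

lemma sat_after_imp:
  assumes "finite D" "max_time D < n" "max_time D < m" "sat (least_model D) n q"
  shows "sat (least_model D) m q"
  using assms(2-)
proof (induction q arbitrary: n m)
  case (Until q r)
  from Until.prems(3) obtain k where "k > n" "sat (least_model D) k r" by auto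
  then have "sat (least_model D) (Suc m) r"
    using Until.IH(2)[of k "Suc m"] Until.prems by simp
  then show ?case by (auto intro!: exI[of _ "Suc m"])
next
  case (And q r)
  then show ?case unfolding sat.simps by blast
qed (simp_all add: least_model_after[OF assms(1)])

text \<open>This justifies representing the infinite empty tail by the single state
  \<open>max_time D + 1\<close>.\<close>

lemma sat_min_iff:
  assumes "finite D"
  shows "sat (least_model D) (min n (max_time D + 1)) q \<longleftrightarrow> sat (least_model D) n q"
proof (cases "n \<le> max_time D + 1")
  case False
  then show ?thesis
    using sat_after_imp[OF assms, of n "max_time D + 1"] sat_after_imp[OF assms, of "max_time D + 1" n]
    by (auto simp: min_def)
qed simp

section \<open>Shapes of queries\<close>

lemma until_occurs_simps [simp]:
  "\<not> until_occurs (Atom A)" "\<not> until_occurs Top" "\<not> until_occurs Bot"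
  "until_occurs (And q r) \<longleftrightarrow> until_occurs q \<or> until_occurs r" "until_occurs (Until q r)"
  by (auto simp: until_occurs_def)

lemma Q_Us_simps [simp]:
  "Atom A \<in> Q_Us" "Top \<in> Q_Us" "Bot \<in> Q_Us"
  "And q r \<in> Q_Us \<longleftrightarrow> q \<in> Q_Us \<and> r \<in> Q_Us"
  "Until q r \<in> Q_Us \<longleftrightarrow> \<not> until_occurs q \<and> r \<in> Q_Us"
proof -
  show "Until q r \<in> Q_Us \<longleftrightarrow> \<not> until_occurs q \<and> r \<in> Q_Us"
  proof (cases "until_occurs q")
    case True
    then show ?thesis by (auto simp: Q_Us_def)
  next
    case False
    then have "Until q1 q2 \<notin> subqueries q" for q1 q2 by (auto simp: until_occurs_def)
    with False show ?thesis by (auto simp: Q_Us_def)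
  qed
  show "And q r \<in> Q_Us \<longleftrightarrow> q \<in> Q_Us \<and> r \<in> Q_Us"
    unfolding Q_Us_def by auto
qed (simp_all add: Q_Us_def)

lemma atom_conjs_no_until: "q \<in> atom_conjs \<Longrightarrow> \<not> until_occurs q"
  by (induction rule: atom_conjs.induct) auto

lemma atom_conjs_Q_Us: "q \<in> atom_conjs \<Longrightarrow> q \<in> Q_Us"
  by (induction rule: atom_conjs.induct) auto

lemma atom_conj_of_set:
  assumes "finite X"
  obtains q where "q \<in> atom_conjs" "\<And>I n. sat I n q \<longleftrightarrow> X \<subseteq> I n"
proof -
  have "\<exists>q\<in>atom_conjs. \<forall>I n. sat I n q \<longleftrightarrow> X \<subseteq> I n"
    using assms
  proof induction
    case empty
    show ?case by (rule bexI[of _ Top]) (auto intro: atom_conjs.intros)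
  next
    case (insert A X)
    then obtain q where "q \<in> atom_conjs" "\<forall>I n. sat I n q \<longleftrightarrow> X \<subseteq> I n" by blast
    then show ?case by (intro bexI[of _ "And (Atom A) q"]) (auto intro: atom_conjs.intros)
  qed
  then show ?thesis using that by blast
qed

lemma Q_Us_conj_of_set:
  assumes "finite X" "X \<subseteq> Q_Us"
  obtains q where "q \<in> Q_Us" "\<And>I n. sat I n q \<longleftrightarrow> (\<forall>c\<in>X. sat I n c)"
proof -
  have "\<exists>q\<in>Q_Us. \<forall>I n. sat I n q \<longleftrightarrow> (\<forall>c\<in>X. sat I n c)"
    using assms
  proof induction
    case empty
    show ?case by (rule bexI[of _ Top]) auto
  next
    case (insert c X)
    then obtain q where "q \<in> Q_Us" "\<forall>I n. sat I n q \<longleftrightarrow> (\<forall>c\<in>X. sat I n c)" by blast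
    with insert show ?case by (intro bexI[of _ "And c q"]) auto
  qed
  then show ?thesis using that by blast
qed

text \<open>An until-free query is a conjunction of atoms, \<open>Top\<close> and
  \<open>Bot\<close>: its atoms belong to every label in the family, hence to the intersection, and
  \<open>Bot\<close> is excluded because it would have to hold at some member of \<open>K\<close>.
  The members of \<open>K\<close> are pointed interpretations, so points of different examples can
  be intersected.\<close>

lemma sat_Inter:
  assumes "\<not> until_occurs q" "K \<noteq> {}" "\<And>I n. (I, n) \<in> K \<Longrightarrow> sat I n q"
    and "(\<Inter>(I, n)\<in>K. I n) \<subseteq> J t"
  shows "sat J t q"
  using assms
proof (induction q)
  case (Atom A)
  then have "A \<in> (\<Inter>(I, n)\<in>K. I n)" by auto
  with Atom.prems(4) show ?case by auto
qed auto

section \<open>Transition systems of data instances\<close>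

lemma data_ts_simps [simp]:
  "ts_states (data_ts \<Sigma> D) = {0..max_time D + 1}"
  "ts_start (data_ts \<Sigma> D) = {0}"
  "(j, k) \<in> ts_trans (data_ts \<Sigma> D) \<longleftrightarrow>
     j < k \<and> k \<le> max_time D + 1 \<or> j = max_time D + 1 \<and> k = max_time D + 1"
  by (auto simp: data_ts_def Let_def)

lemma data_ts_label: "finite D \<Longrightarrow> ts_label (data_ts \<Sigma> D) j = least_model D j"
  using least_model_after[of D j] by (auto simp: data_ts_def Let_def least_model_def)

lemma data_ts_tlabel_loop:
  "ts_tlabel (data_ts \<Sigma> D) (max_time D + 1) (max_time D + 1) = with_bot \<Sigma>"
  by (simp add: data_ts_def Let_def)

lemma data_ts_tlabel_less:
  assumes "j < k"
  shows "ts_tlabel (data_ts \<Sigma> D) j k =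
     {x \<in> with_bot \<Sigma>. \<forall>n. j < n \<and> n < k \<longrightarrow> (\<exists>A. x = Some A \<and> A \<in> least_model D n)}"
proof -
  have "\<not> (j = max_time D + 1 \<and> k = max_time D + 1)" using assms by linarith
  then show ?thesis
    by (simp only: data_ts_def Let_def least_model_def tsys.select_convs if_False mem_Collect_eq)
qed

lemma data_ts_tlabel_subset: "ts_tlabel (data_ts \<Sigma> D) j k \<subseteq> with_bot \<Sigma>"
  by (auto simp: data_ts_def Let_def)

text \<open>In the following two rules the loop at \<open>max_time D + 1\<close> and an ordinary transition
  are treated alike, since the interval between \<open>j\<close> and \<open>k\<close> is empty for the loop.\<close>

lemma data_ts_tlabelI:
  assumes "(j, k) \<in> ts_trans (data_ts \<Sigma> D)" "x \<in> with_bot \<Sigma>"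
    and "\<And>n. j < n \<Longrightarrow> n < k \<Longrightarrow> \<exists>A. x = Some A \<and> A \<in> least_model D n"
  shows "x \<in> ts_tlabel (data_ts \<Sigma> D) j k"
proof (cases "j < k")
  case True
  then show ?thesis unfolding data_ts_tlabel_less[OF True] using assms(2,3) by blast
next
  case False
  then have "j = max_time D + 1" "k = max_time D + 1" using assms(1) by auto
  then show ?thesis using assms(2) by (simp only: data_ts_tlabel_loop)
qed

lemma data_ts_tlabelD:
  assumes "x \<in> ts_tlabel (data_ts \<Sigma> D) j k" "j < n" "n < k"
  shows "\<exists>A. x = Some A \<and> A \<in> least_model D n"
  using assms data_ts_tlabel_less[of j k \<Sigma> D] by auto

text \<open>The semantic witness may lie far beyond the data; it is capped at the last
  state.\<close>

lemma data_ts_until_witness: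
  assumes "finite D" "j \<le> max_time D + 1" "sat (least_model D) j (Until q r)"
  obtains k where "(j, k) \<in> ts_trans (data_ts \<Sigma> D)" "sat (least_model D) k r"
    "\<And>n. j < n \<Longrightarrow> n < k \<Longrightarrow> sat (least_model D) n q"
proof -
  obtain m where m: "m > j" "sat (least_model D) m r"
    "\<And>n. j < n \<Longrightarrow> n < m \<Longrightarrow> sat (least_model D) n q"
    using assms(3) unfolding sat.simps by blast
  show ?thesis
  \<comment> \<open>Capping only shrinks the interval. If \<open>j\<close> is already the last
    state, the capped witness gives the loop.\<close>
  proof (rule that[of "min m (max_time D + 1)"])
    show "sat (least_model D) (min m (max_time D + 1)) r"
      using m(2) by (simp only: sat_min_iff[OF assms(1)])
    show "(j, min m (max_time D + 1)) \<in> ts_trans (data_ts \<Sigma> D)"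
      using m(1) assms(2) unfolding data_ts_simps by linarith
    show "sat (least_model D) n q" if "j < n" "n < min m (max_time D + 1)" for n
      using m(3) that by simp
  qed
qed

text \<open>Converse of the preceding extraction of a transition from \<open>Until\<close>. The loop
  stays in one state while time must advance strictly, so there the witness is taken one point
  later, where the same queries hold.\<close>

lemma data_ts_until:
  assumes "finite D" "(j, k) \<in> ts_trans (data_ts \<Sigma> D)" "sat (least_model D) k r"
    and "\<And>n. j < n \<Longrightarrow> n < k \<Longrightarrow> sat (least_model D) n q"
  shows "sat (least_model D) j (Until q r)"
proof (cases "j < k")
  case True
  then show ?thesis using assms(3,4) unfolding sat.simps by blast
next
  case False
  then have "j = max_time D + 1" "k = max_time D + 1" using assms(2) by auto
  with assms(3) have "sat (least_model D) (Suc j) r"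
    using sat_after_imp[OF assms(1), of k "Suc j"] by simp
  then show ?thesis by (auto intro!: exI[of _ "Suc j"])
qed

section \<open>Componentwise description of disjoint unions and products\<close>

lemma ts_union_simps [simp]:
  "ts_states (ts_union I S) = (SIGMA i:I. ts_states (S i))"
  "ts_label (ts_union I S) z = ts_label (S (fst z)) (snd z)"
  "(z, w) \<in> ts_trans (ts_union I S) \<longleftrightarrow>
     fst z \<in> I \<and> fst w = fst z \<and> (snd z, snd w) \<in> ts_trans (S (fst z))"
  "ts_tlabel (ts_union I S) z w = ts_tlabel (S (fst z)) (snd z) (snd w)"
  "ts_start (ts_union I S) = (SIGMA i:I. ts_start (S i))"
  by (auto simp: ts_union_def case_prod_beta prod_eq_iff)

lemma ts_product_simps [simp]:
  "ts_states (ts_product I S) = (\<Pi>\<^sub>E i\<in>I. ts_states (S i))"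
  "ts_label (ts_product I S) s = (\<Inter>i\<in>I. ts_label (S i) (s i))"
  "(s, p) \<in> ts_trans (ts_product I S) \<longleftrightarrow>
     s \<in> (\<Pi>\<^sub>E i\<in>I. ts_states (S i)) \<and> p \<in> (\<Pi>\<^sub>E i\<in>I. ts_states (S i)) \<and>
     (\<forall>i\<in>I. (s i, p i) \<in> ts_trans (S i))"
  "ts_tlabel (ts_product I S) s p = (\<Inter>i\<in>I. ts_tlabel (S i) (s i) (p i))"
  "ts_start (ts_product I S) = (\<Pi>\<^sub>E i\<in>I. ts_start (S i))"
  by (auto simp: ts_product_def)

section \<open>Single transitions and \<open>\<U>\<close>\<close>

text \<open>With \<open>Ipos\<close> nonempty, each label of the product is bounded by the label of
  one component. This makes state labels finite and keeps transition labels inside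
  \<open>with_bot \<Sigma>\<close>.\<close>

locale examples =
  fixes \<D> :: "'i \<Rightarrow> 'a data" and Ipos Ineg :: "'i set" and \<Sigma> :: "'a set"
  assumes Ipos_nonempty: "Ipos \<noteq> {}"
    and finite_data: "\<And>i. i \<in> Ipos \<union> Ineg \<Longrightarrow> finite (\<D> i)"
    and atoms_pos: "\<And>i. i \<in> Ipos \<Longrightarrow> fst ` \<D> i \<subseteq> \<Sigma>"
begin

abbreviation S where "S i \<equiv> data_ts \<Sigma> (\<D> i)"
abbreviation P where "P \<equiv> ts_product Ipos S"
abbreviation N where "N \<equiv> ts_union Ineg S"

definition satP :: "('i \<Rightarrow> nat) \<Rightarrow> 'a query \<Rightarrow> bool" where
  "satP s q \<longleftrightarrow> (\<forall>i\<in>Ipos. sat (least_model (\<D> i)) (s i) q)"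

definition satN :: "'i \<times> nat \<Rightarrow> 'a query \<Rightarrow> bool" where
  "satN z q \<longleftrightarrow> sat (least_model (\<D> (fst z))) (snd z) q"

lemma label_P: "ts_label P s = (\<Inter>i\<in>Ipos. least_model (\<D> i) (s i))"
  by (simp add: data_ts_label finite_data)

lemma label_N: "z \<in> ts_states N \<Longrightarrow> ts_label N z = least_model (\<D> (fst z)) (snd z)"
  by (auto simp: data_ts_label finite_data)

lemma finite_label_P: "finite (ts_label P s)"
proof -
  obtain i where i: "i \<in> Ipos" using Ipos_nonempty by blast
  then have "ts_label P s \<subseteq> fst ` \<D> i" unfolding label_P by (force simp: least_model_def)
  then show ?thesis using finite_data i by (meson UnI1 finite_imageI finite_subset)
qed

text \<open>The characteristic query of a product state: the finite conjunction of the atoms common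
  to all positive components.\<close>

lemma label_query:
  obtains q where "q \<in> atom_conjs" "satP s q"
    "\<And>z. z \<in> ts_states N \<Longrightarrow> satN z q \<Longrightarrow> ts_label P s \<subseteq> ts_label N z"
proof -
  obtain q where q: "q \<in> atom_conjs" "\<And>I n. sat I n q \<longleftrightarrow> ts_label P s \<subseteq> I n"
    using atom_conj_of_set[OF finite_label_P] by blast
  show ?thesis
  proof (rule that[OF q(1)])
    show "satP s q" unfolding satP_def q(2) label_P by blast
    show "ts_label P s \<subseteq> ts_label N z" if "z \<in> ts_states N" "satN z q" for z
      using that(2) unfolding satN_def q(2) label_N[OF that(1)] .
  qed
qed

text \<open>The label of \<open>s\<close> is the intersection of the component labels, so for
  until-free queries its inclusion in the label of \<open>z\<close> suffices.\<close>

lemma label_transfer: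
  assumes "\<not> until_occurs q" "satP s q" "z \<in> ts_states N" "ts_label P s \<subseteq> ts_label N z"
  shows "satN z q"
  unfolding satN_def
proof (rule sat_Inter[OF assms(1)])
  show "(\<lambda>i. (least_model (\<D> i), s i)) ` Ipos \<noteq> {}" using Ipos_nonempty by simp
  show "(\<Inter>(I, n)\<in>(\<lambda>i. (least_model (\<D> i), s i)) ` Ipos. I n) \<subseteq> least_model (\<D> (fst z)) (snd z)"
    using assms(4) unfolding label_P label_N[OF assms(3)] by auto
qed (use assms(2) in \<open>auto simp: satP_def\<close>)

lemma tlabel_P_subset: "ts_tlabel P s p \<subseteq> with_bot \<Sigma>"
proof -
  obtain i where "i \<in> Ipos" using Ipos_nonempty by blast
  then show ?thesis using data_ts_tlabel_subset[of \<Sigma> "\<D> i" "s i" "p i"] by auto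
qed

text \<open>A component label contains \<open>\<bottom>\<close> exactly when no time point lies
  strictly between the two states, so losing \<open>\<bottom>\<close> in the intersection exposes a
  component with an interior point.\<close>

lemma None_tlabel_P:
  assumes "(s, p) \<in> ts_trans P" "None \<notin> ts_tlabel P s p"
  obtains i n where "i \<in> Ipos" "s i < n" "n < p i"
proof -
  obtain i where i: "i \<in> Ipos" "None \<notin> ts_tlabel (S i) (s i) (p i)" using assms(2) by auto
  have "(s i, p i) \<in> ts_trans (S i)" using assms(1) i(1) by (simp del: data_ts_simps)
  then have "\<exists>n. s i < n \<and> n < p i"
    using i(2) data_ts_tlabelI[of "s i" "p i" \<Sigma> "\<D> i" None] by (auto simp: with_bot_def)
  then show ?thesis using that i(1) by blast
qed

text \<open>Choosing a witness in every positive example yields one product transition whose label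
  collects the facts shared by all interior points. Any transition of \<open>N\<close> with a larger
  label satisfies \<open>lam\<close> at its own interior points. The choice of \<open>p\<close> is
  independent of the query \<open>q'\<close> reached in \<open>N\<close>.\<close>

lemma until_advance:
  assumes "s \<in> ts_states P" "satP s (Until lam q)" "\<not> until_occurs lam"
  obtains p where "(s, p) \<in> ts_trans P" "satP p q"
    "\<And>z w q'. (z, w) \<in> ts_trans N \<Longrightarrow> ts_tlabel P s p \<subseteq> ts_tlabel N z w \<Longrightarrow> satN w q'
       \<Longrightarrow> satN z (Until lam q')"
proof -
  have "\<exists>k. (s i, k) \<in> ts_trans (S i) \<and> sat (least_model (\<D> i)) k q \<and>
      (\<forall>n. s i < n \<and> n < k \<longrightarrow> sat (least_model (\<D> i)) n lam)" if "i \<in> Ipos" for i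
  proof -
    have "finite (\<D> i)" "s i \<le> max_time (\<D> i) + 1" "sat (least_model (\<D> i)) (s i) (Until lam q)"
      using that assms(1,2) finite_data by (auto simp: satP_def simp del: sat.simps)
    then show ?thesis using data_ts_until_witness[of "\<D> i" "s i" lam q \<Sigma>] by metis
  qed
  then obtain k where k: "\<And>i. i \<in> Ipos \<Longrightarrow> (s i, k i) \<in> ts_trans (S i)"
      "\<And>i. i \<in> Ipos \<Longrightarrow> sat (least_model (\<D> i)) (k i) q"
      "\<And>i n. i \<in> Ipos \<Longrightarrow> s i < n \<Longrightarrow> n < k i \<Longrightarrow> sat (least_model (\<D> i)) n lam"
    by metis
  define p where "p = restrict k Ipos"
  have p: "(s, p) \<in> ts_trans P"
    using assms(1) k(1) unfolding p_def ts_product_simps by fastforce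
  show ?thesis
  proof (rule that[OF p])
    show "satP p q" using k(2) by (simp add: satP_def p_def)
    fix z w q'
    assume zw: "(z, w) \<in> ts_trans N" and sub: "ts_tlabel P s p \<subseteq> ts_tlabel N z w"
      and q': "satN w q'"
    let ?j = "fst z"
    have j: "?j \<in> Ineg" "fst w = ?j" "(snd z, snd w) \<in> ts_trans (S ?j)" using zw by simp_all
    have sub': "ts_tlabel P s p \<subseteq> ts_tlabel (S ?j) (snd z) (snd w)" using sub by simp
    have "sat (least_model (\<D> ?j)) n lam" if n: "snd z < n" "n < snd w" for n
    proof (rule sat_Inter[OF assms(3)])
      let ?K = "{(least_model (\<D> i), m) | i m. i \<in> Ipos \<and> s i < m \<and> m < p i}"
      \<comment> \<open>The interior point \<open>n\<close> on the negative side rules out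
        \<open>\<bottom>\<close>, so some positive interval has an interior point as well and
        \<open>?K\<close> is nonempty.\<close>
      have "None \<notin> ts_tlabel P s p" using sub' data_ts_tlabelD[OF _ n, of None] by blast
      then obtain i0 n0 where i0: "i0 \<in> Ipos" "s i0 < n0" "n0 < p i0"
        using None_tlabel_P[OF p] by blast
      then show "?K \<noteq> {}" by blast
      show "(\<Inter>(I, m)\<in>?K. I m) \<subseteq> least_model (\<D> ?j) n"
      proof
        fix A assume "A \<in> (\<Inter>(I, m)\<in>?K. I m)"
        then have A: "A \<in> least_model (\<D> i) m" if "i \<in> Ipos" "s i < m" "m < p i" for i m
          using that by blast
        \<comment> \<open>The actual point \<open>n0\<close> is needed here: a component with an
          empty interval has all of \<open>with_bot \<Sigma>\<close> as its label, so
          \<open>A\<close> must be known to lie in \<open>\<Sigma>\<close>.\<close>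
        have "A \<in> \<Sigma>" using A[OF i0] atoms_pos[OF i0(1)] by (force simp: least_model_def)
        then have "Some A \<in> ts_tlabel (S i) (s i) (p i)" if "i \<in> Ipos" for i
          using p that A by (intro data_ts_tlabelI) (auto simp: with_bot_def simp del: data_ts_simps)
        then have "Some A \<in> ts_tlabel (S ?j) (snd z) (snd w)" using sub' by auto
        then show "A \<in> least_model (\<D> ?j) n" using data_ts_tlabelD n by blast
      qed
      show "sat I m lam" if "(I, m) \<in> ?K" for I m
        using that k(3) by (auto simp: p_def)
    qed
    then show "satN z (Until lam q')"
      using data_ts_until[OF _ j(3)] j(1,2) q' finite_data by (simp add: satN_def del: sat.simps)
  qed
qed

text \<open>A transition is described by the left argument of \<open>Until\<close>:
  \<open>Bot\<close> if its label contains \<open>\<bottom>\<close>, which forbids interior points,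
  and otherwise the conjunction of the atoms in the label.\<close>

lemma until_query:
  assumes p: "(s, p) \<in> ts_trans P"
  obtains lam where "lam \<in> atom_conjs \<union> {Bot}" "\<And>q. satP p q \<Longrightarrow> satP s (Until lam q)"
    "\<And>z q. z \<in> ts_states N \<Longrightarrow> satN z (Until lam q) \<Longrightarrow>
       \<exists>w. w \<in> ts_states N \<and> (z, w) \<in> ts_trans N \<and> ts_tlabel P s p \<subseteq> ts_tlabel N z w \<and> satN w q"
proof -
  let ?X = "{A. Some A \<in> ts_tlabel P s p}"
  have tr: "(s i, p i) \<in> ts_trans (S i)" if "i \<in> Ipos" for i
    using p that by (simp del: data_ts_simps)
  \<comment> \<open>One condition covers both forms of \<open>lam\<close>: an element
    \<open>None\<close> of the label makes the right-hand side unsatisfiable, just like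
    \<open>Bot\<close>.\<close>
  have "\<exists>lam \<in> atom_conjs \<union> {Bot}. \<forall>I n. sat I n lam \<longleftrightarrow>
      (\<forall>x\<in>ts_tlabel P s p. \<exists>A. x = Some A \<and> A \<in> I n)"
  proof (cases "None \<in> ts_tlabel P s p")
    case True
    then show ?thesis by (intro bexI[of _ Bot]) (auto simp del: ts_product_simps)
  next
    case False
    \<comment> \<open>At an interior point of component \<open>i\<close>, all atoms of the label are
      facts of the finite instance \<open>\<D> i\<close>. This makes the conjunction finite.\<close>
    then obtain i n where i: "i \<in> Ipos" "s i < n" "n < p i" using None_tlabel_P[OF p] by blast
    have "?X \<subseteq> fst ` \<D> i"
    proof
      fix A assume "A \<in> ?X"
      then have "Some A \<in> ts_tlabel (S i) (s i) (p i)" using i(1) by simp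
      from data_ts_tlabelD[OF this i(2,3)] show "A \<in> fst ` \<D> i"
        by (force simp: least_model_def)
    qed
    then have "finite ?X" using finite_data i(1) by (meson UnI1 finite_imageI finite_subset)
    then obtain lam where "lam \<in> atom_conjs" "\<And>I n. sat I n lam \<longleftrightarrow> ?X \<subseteq> I n"
      using atom_conj_of_set by blast
    moreover have "\<forall>x\<in>ts_tlabel P s p. \<exists>A. x = Some A" using False by (metis option.exhaust)
    ultimately show ?thesis by (intro bexI[of _ lam]) (fastforce simp del: ts_product_simps)+
  qed
  then obtain lam where lam: "lam \<in> atom_conjs \<union> {Bot}"
      "\<And>I n. sat I n lam \<longleftrightarrow> (\<forall>x\<in>ts_tlabel P s p. \<exists>A. x = Some A \<and> A \<in> I n)"
    by blast
  show ?thesis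
  proof (rule that[OF lam(1)])
    fix q assume q: "satP p q"
    have "sat (least_model (\<D> i)) (s i) (Until lam q)" if i: "i \<in> Ipos" for i
    proof (rule data_ts_until[OF _ tr[OF i]])
      show "finite (\<D> i)" using finite_data i by blast
      show "sat (least_model (\<D> i)) (p i) q" using q i by (simp add: satP_def)
      show "sat (least_model (\<D> i)) n lam" if "s i < n" "n < p i" for n
        unfolding lam(2) using data_ts_tlabelD[of _ \<Sigma> "\<D> i" "s i" "p i" n] that i by auto
    qed
    then show "satP s (Until lam q)" by (simp add: satP_def del: sat.simps)
  next
    fix z q assume z: "z \<in> ts_states N" and until: "satN z (Until lam q)"
    let ?j = "fst z"
    have j: "?j \<in> Ineg" "snd z \<le> max_time (\<D> ?j) + 1" using z by auto
    then obtain k where k: "(snd z, k) \<in> ts_trans (S ?j)" "sat (least_model (\<D> ?j)) k q"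
        "\<And>n. snd z < n \<Longrightarrow> n < k \<Longrightarrow> sat (least_model (\<D> ?j)) n lam"
      using data_ts_until_witness[of "\<D> ?j" "snd z" lam q \<Sigma>] finite_data until
      by (auto simp: satN_def simp del: sat.simps)
    have "ts_tlabel P s p \<subseteq> ts_tlabel (S ?j) (snd z) k"
      using data_ts_tlabelI[OF k(1)] k(3) tlabel_P_subset[of s p] unfolding lam(2)
      by (meson subset_iff)
    then show "\<exists>w. w \<in> ts_states N \<and> (z, w) \<in> ts_trans N \<and>
        ts_tlabel P s p \<subseteq> ts_tlabel N z w \<and> satN w q"
      using j k(1,2) by (intro exI[of _ "(?j, k)"]) (auto simp: satN_def simp del: ts_product_simps)
  qed
qed

end

section \<open>Trees of runs\<close>

lemma runs_snoc:
  assumes "r \<in> runs X" "x \<in> ts_states X" "(last r, x) \<in> ts_trans X"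
  shows "r @ [x] \<in> runs X"
proof -
  have "((r @ [x]) ! k, (r @ [x]) ! Suc k) \<in> ts_trans X" if "Suc k < length (r @ [x])" for k
  proof (cases "Suc k < length r")
    case True
    then show ?thesis using assms(1) by (simp add: runs_def nth_append)
  next
    case False
    then have "k = length r - 1" "r \<noteq> []" using that assms(1) by (auto simp: runs_def)
    then show ?thesis using assms(3) by (simp add: nth_append last_conv_nth)
  qed
  then show ?thesis using assms(1,2) by (auto simp: runs_def)
qed

lemma runs_snocD:
  assumes "r @ [x] \<in> runs X" "r \<noteq> []"
  shows "r \<in> runs X" "x \<in> ts_states X" "(last r, x) \<in> ts_trans X"
proof -
  have step: "((r @ [x]) ! k, (r @ [x]) ! Suc k) \<in> ts_trans X" if "Suc k < Suc (length r)" for k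
    using assms(1) that by (auto simp: runs_def)
  have "(r ! k, r ! Suc k) \<in> ts_trans X" if "Suc k < length r" for k
    using step[of k] that by (simp add: nth_append)
  then show "r \<in> runs X" "x \<in> ts_states X" using assms by (auto simp: runs_def)
  show "(last r, x) \<in> ts_trans X"
    using step[of "length r - 1"] assms(2) by (simp add: nth_append last_conv_nth)
qed

lemma runs_nonempty: "r \<in> runs X \<Longrightarrow> r \<noteq> []"
  by (simp add: runs_def)

lemma runs_last: "r \<in> runs X \<Longrightarrow> last r \<in> ts_states X"
  by (auto simp: runs_def)

lemma tree_homD:
  assumes "tree_hom X T Y h" "t \<in> T"
  shows "h t \<in> runs Y"
    and "node_label X t \<subseteq> node_label Y (h t)"
    and "u \<in> T \<Longrightarrow> (t, u) \<in> tree_edges X \<Longrightarrow> (h t, h u) \<in> tree_edges Y"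
    and "u \<in> T \<Longrightarrow> (t, u) \<in> tree_edges X \<Longrightarrow> edge_label X t u \<subseteq> edge_label Y (h t) (h u)"
    and "t \<in> tree_roots X \<Longrightarrow> h t \<in> tree_roots Y"
  using assms by (simp_all add: tree_hom_def Pi_iff)

lemma tree_hom_subset:
  assumes "tree_hom X T Y h" "T' \<subseteq> T"
  shows "tree_hom X T' Y h"
  unfolding tree_hom_def
proof (intro conjI ballI impI Pi_I)
  fix t assume "t \<in> T'"
  with assms(2) have t: "t \<in> T" by blast
  show "h t \<in> runs Y" "node_label X t \<subseteq> node_label Y (h t)"
    by (rule tree_homD[OF assms(1) t])+
  fix u assume "u \<in> T'" and e: "(t, u) \<in> tree_edges X"
  with assms(2) have u: "u \<in> T" by blast
  show "(h t, h u) \<in> tree_edges Y" "edge_label X t u \<subseteq> edge_label Y (h t) (h u)"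
    by (rule tree_homD(3,4)[OF assms(1) t u e])+
next
  fix t assume "t \<in> T' \<inter> tree_roots X"
  then show "h t \<in> tree_roots Y" using assms tree_homD(5)[OF assms(1)] by blast
qed

text \<open>Identifies the child of \<open>r\<close> through which the path from \<open>r\<close>
  down to \<open>t\<close> passes.\<close>

lemma prefix_snoc_cases:
  assumes "prefix r t" "t \<noteq> r"
  shows "prefix (r @ [t ! length r]) t"
proof -
  obtain x zs where "t = r @ x # zs" using assms by (metis prefix_def append_Nil2 neq_Nil_conv)
  then show ?thesis by (simp add: prefix_def)
qed

declare data_ts_simps [simp del] ts_union_simps [simp del] ts_product_simps [simp del]

context examples
begin

text \<open>The tree is grown along the query: \<open>And\<close> takes the union of two trees with
  the same root, and \<open>Until\<close> hangs a tree below a one-step extension of the root. The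
  root is an arbitrary run, not only a start state, so that the induction can descend.\<close>

lemma tree_of_query:
  assumes "q \<in> Q_Us" "r \<in> runs P" "satP (last r) q"
  shows "\<exists>T. finite T \<and> T \<subseteq> runs P \<and> r \<in> T \<and> (\<forall>t\<in>T. prefix r t) \<and>
    (\<forall>t\<in>T. \<forall>p. prefix r p \<and> prefix p t \<longrightarrow> p \<in> T) \<and>
    (\<forall>h. tree_hom P T N h \<longrightarrow> satN (last (h r)) q)"
  using assms
proof (induction q arbitrary: r)
  case (And q1 q2)
  have "q1 \<in> Q_Us" "q2 \<in> Q_Us" "satP (last r) q1" "satP (last r) q2"
    using And.prems by (auto simp: satP_def)
  from And.IH(1)[OF this(1) And.prems(2) this(3)] And.IH(2)[OF this(2) And.prems(2) this(4)]
  obtain T1 T2 where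
    T1: "finite T1" "T1 \<subseteq> runs P" "r \<in> T1" "\<forall>t\<in>T1. prefix r t"
      "\<forall>t\<in>T1. \<forall>p. prefix r p \<and> prefix p t \<longrightarrow> p \<in> T1"
      "\<forall>h. tree_hom P T1 N h \<longrightarrow> satN (last (h r)) q1" and
    T2: "finite T2" "T2 \<subseteq> runs P" "r \<in> T2" "\<forall>t\<in>T2. prefix r t"
      "\<forall>t\<in>T2. \<forall>p. prefix r p \<and> prefix p t \<longrightarrow> p \<in> T2"
      "\<forall>h. tree_hom P T2 N h \<longrightarrow> satN (last (h r)) q2"
    by (elim exE conjE) rule
  have "satN (last (h r)) (And q1 q2)" if "tree_hom P (T1 \<union> T2) N h" for h
    using T1(6) T2(6) tree_hom_subset[OF that, of T1] tree_hom_subset[OF that, of T2]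
    by (auto simp: satN_def)
  then show ?case using T1(1-5) T2(1-5) by (intro exI[of _ "T1 \<union> T2"]) blast
next
  case (Until lam q)
  \<comment> \<open>The restriction defining \<open>Q_Us\<close> enters here: since
    \<open>lam\<close> is until-free, transition labels carry enough information to transfer
    it.\<close>
  have "\<not> until_occurs lam" "q \<in> Q_Us" using Until.prems by auto
  obtain p where p: "(last r, p) \<in> ts_trans P" "satP p q"
    "\<And>z w q'. (z, w) \<in> ts_trans N \<Longrightarrow> ts_tlabel P (last r) p \<subseteq> ts_tlabel N z w \<Longrightarrow> satN w q'
       \<Longrightarrow> satN z (Until lam q')"
    using until_advance[OF runs_last[OF Until.prems(2)] Until.prems(3) \<open>\<not> until_occurs lam\<close>] by blast
  have rp: "r @ [p] \<in> runs P"
    using p(1) Until.prems(2) by (intro runs_snoc) (auto simp: ts_product_simps)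
  obtain T where T: "finite T" "T \<subseteq> runs P" "r @ [p] \<in> T" "\<forall>t\<in>T. prefix (r @ [p]) t"
      "\<forall>t\<in>T. \<forall>p'. prefix (r @ [p]) p' \<and> prefix p' t \<longrightarrow> p' \<in> T"
      "\<forall>h. tree_hom P T N h \<longrightarrow> satN (last (h (r @ [p]))) q"
    using Until.IH(2)[OF \<open>q \<in> Q_Us\<close> rp] p(2) by auto
  show ?case
  proof (intro exI[of _ "insert r T"] conjI allI ballI impI)
    show "prefix r t" if "t \<in> insert r T" for t
      using that T(4) append_prefixD by fastforce
    show "p' \<in> insert r T" if t: "t \<in> insert r T" and p': "prefix r p' \<and> prefix p' t" for t p'
    proof (cases "p' = r \<or> t = r")
      case True
      then show ?thesis using p' prefix_order.antisym by blast
    next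
      case False
      \<comment> \<open>Both \<open>p'\<close> and \<open>r @ [p]\<close> are prefixes of
        \<open>t\<close>, and \<open>p'\<close> is strictly longer than \<open>r\<close>, so
        \<open>p'\<close> extends \<open>r @ [p]\<close> and prefix closure of \<open>T\<close>
        applies.\<close>
      then have "t \<in> T" "prefix (r @ [p]) t" using t T(4) by auto
      moreover have "prefix (r @ [p' ! length r]) p'" using prefix_snoc_cases p' False by blast
      ultimately have "prefix (r @ [p]) p'"
        using p' by (metis length_append_singleton prefix_length_le
            prefix_length_prefix prefix_order.trans prefix_same_cases)
      then show ?thesis using T(5) \<open>t \<in> T\<close> p' by blast
    qed
    fix h assume h: "tree_hom P (insert r T) N h"
    have "(r, r @ [p]) \<in> tree_edges P" using Until.prems(2) rp by (auto simp: tree_edges_def)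
    then have e: "(h r, h (r @ [p])) \<in> tree_edges N"
        "edge_label P r (r @ [p]) \<subseteq> edge_label N (h r) (h (r @ [p]))"
      using tree_homD(3,4)[OF h, of r "r @ [p]"] T(3) by simp_all
    \<comment> \<open>An image edge prolongs the run \<open>h r\<close> by one state
      \<open>w\<close>; this step is the transition of \<open>N\<close> to which \<open>p(3)\<close>
      is applied.\<close>
    from e(1) obtain w where w: "h (r @ [p]) = h r @ [w]" "h r \<in> runs N" "h r @ [w] \<in> runs N"
      by (auto simp: tree_edges_def)
    then have "(last (h r), w) \<in> ts_trans N"
      using runs_snocD(3)[OF w(3)] by (auto simp: runs_def)
    moreover have "ts_tlabel P (last r) p \<subseteq> ts_tlabel N (last (h r)) w"
      using e(2) w(1) by (simp add: edge_label_def)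
    moreover have "satN w q" 
      using T(6)[rule_format, OF tree_hom_subset[OF h subset_insertI]] w(1) by simp
    ultimately show "satN (last (h r)) (Until lam q)" by (rule p(3))
  qed (use T(1,2) Until.prems(2) in auto)
next
  case (Atom A)
  have "satN (last (h r)) (Atom A)" if h: "tree_hom P {r} N h" for h
  proof (rule label_transfer)
    show "satP (last r) (Atom A)" by (rule Atom.prems(3))
    show "last (h r) \<in> ts_states N" using h by (intro runs_last) (auto simp: tree_hom_def)
    show "ts_label P (last r) \<subseteq> ts_label N (last (h r))"
      using h by (auto simp: tree_hom_def node_label_def)
  qed simp
  then show ?case using Atom.prems(2) prefix_order.antisym by (intro exI[of _ "{r}"]) auto
next
  case Top
  then show ?case using prefix_order.antisym by (intro exI[of _ "{r}"]) (auto simp: satN_def)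
next
  case Bot
  then show ?case using Ipos_nonempty by (auto simp: satP_def)
qed

text \<open>The query describes the part of \<open>T\<close> below \<open>r\<close>: the label of
  \<open>r\<close> together with one \<open>Until\<close> for each child. Fixing the image
  \<open>r'\<close> of \<open>r\<close> in advance allows homomorphisms of the child subtrees to be
  glued at \<open>r'\<close>.\<close>

lemma query_of_tree:
  assumes "finite T" "T \<subseteq> runs P" and closed: "\<forall>t\<in>T. \<forall>p. p \<noteq> [] \<and> prefix p t \<longrightarrow> p \<in> T"
    and "r \<in> T"
  shows "\<exists>q\<in>Q_Us. satP (last r) q \<and> (\<forall>r'\<in>runs N. length r' = length r \<longrightarrow> satN (last r') q \<longrightarrow>
    (\<exists>h. tree_hom P {t \<in> T. prefix r t} N h \<and> h r = r'))"
proof -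
  \<comment> \<open>A bound on the depth of \<open>T\<close>; \<open>m - length r\<close> decreases
    from a node to its children and serves as the induction measure.\<close>
  obtain m where m: "\<And>t. t \<in> T \<Longrightarrow> length t \<le> m"
    using finite_imageI[OF assms(1), of length] by (meson Max_ge image_eqI)
  show ?thesis
    using \<open>r \<in> T\<close>
  proof (induction "m - length r" arbitrary: r rule: less_induct)
    case less
    have r: "r \<in> runs P" "r \<noteq> []" using less.prems assms(2) runs_nonempty by blast+
    define C where "C = {s. r @ [s] \<in> T}"
    have "finite C"
      using finite_vimageI[OF assms(1), of "\<lambda>s. r @ [s]"] by (simp add: C_def vimage_def inj_def)
    \<comment> \<open>Data for one child \<open>s\<close>: a matching successor \<open>w\<close> of
      the image, and a homomorphism of the subtree at \<open>r @ [s]\<close> whose root goes to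
      \<open>r' @ [w]\<close>.\<close>
    define ext where "ext s r' w h \<longleftrightarrow> (last r', w) \<in> ts_trans N \<and> w \<in> ts_states N \<and>
        ts_tlabel P (last r) s \<subseteq> ts_tlabel N (last r') w \<and>
        tree_hom P {t \<in> T. prefix (r @ [s]) t} N h \<and> h (r @ [s]) = r' @ [w]" for s r' w h
    have "\<exists>c. c \<in> Q_Us \<and> satP (last r) c \<and>
        (\<forall>r'\<in>runs N. length r' = length r \<longrightarrow> satN (last r') c \<longrightarrow> (\<exists>w h. ext s r' w h))" if "s \<in> C" for s
    proof -
      have rs: "r @ [s] \<in> T" using that by (simp add: C_def)
      then have "m - length (r @ [s]) < m - length r" using m[OF rs] by simp
      from less.hyps[OF this rs] obtain q where q: "q \<in> Q_Us" "satP s q"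
          "\<And>r'. r' \<in> runs N \<Longrightarrow> length r' = Suc (length r) \<Longrightarrow> satN (last r') q \<Longrightarrow>
            \<exists>h. tree_hom P {t \<in> T. prefix (r @ [s]) t} N h \<and> h (r @ [s]) = r'"
        by auto
      have "(last r, s) \<in> ts_trans P" 
        by (rule runs_snocD(3)[OF subsetD[OF assms(2) rs] r(2)])
      then obtain lam where lam: "lam \<in> atom_conjs \<union> {Bot}"
          "\<And>q. satP s q \<Longrightarrow> satP (last r) (Until lam q)"
          "\<And>z q. z \<in> ts_states N \<Longrightarrow> satN z (Until lam q) \<Longrightarrow> \<exists>w. w \<in> ts_states N \<and>
             (z, w) \<in> ts_trans N \<and> ts_tlabel P (last r) s \<subseteq> ts_tlabel N z w \<and> satN w q"
        using until_query by blast
      show ?thesis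
      proof (intro exI[of _ "Until lam q"] conjI ballI impI)
        show "Until lam q \<in> Q_Us" using lam(1) q(1) atom_conjs_no_until by auto
        show "satP (last r) (Until lam q)" by (rule lam(2)[OF q(2)])
        fix r' assume r': "r' \<in> runs N" "length r' = length r" "satN (last r') (Until lam q)"
        then obtain w where w: "w \<in> ts_states N" "(last r', w) \<in> ts_trans N"
            "ts_tlabel P (last r) s \<subseteq> ts_tlabel N (last r') w" "satN w q"
          using lam(3)[OF runs_last] by blast
        have "r' @ [w] \<in> runs N" using runs_snoc r'(1) w(1,2) by metis
        then obtain h where "tree_hom P {t \<in> T. prefix (r @ [s]) t} N h" "h (r @ [s]) = r' @ [w]"
          using q(3)[of "r' @ [w]"] r'(2) w(4) by auto
        with w show "\<exists>w h. ext s r' w h" unfolding ext_def by blast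
      qed
    qed
    then obtain c where c: "\<And>s. s \<in> C \<Longrightarrow> c s \<in> Q_Us \<and> satP (last r) (c s) \<and>
        (\<forall>r'\<in>runs N. length r' = length r \<longrightarrow> satN (last r') (c s) \<longrightarrow> (\<exists>w h. ext s r' w h))"
      by metis
    obtain \<rho> where \<rho>: "\<rho> \<in> atom_conjs" "satP (last r) \<rho>"
        "\<And>z. z \<in> ts_states N \<Longrightarrow> satN z \<rho> \<Longrightarrow> ts_label P (last r) \<subseteq> ts_label N z"
      using label_query by blast
    have "finite (insert \<rho> (c ` C))" "insert \<rho> (c ` C) \<subseteq> Q_Us"
      using \<open>finite C\<close> c \<rho>(1) atom_conjs_Q_Us by auto
    then obtain q where q: "q \<in> Q_Us"
        "\<And>I n. sat I n q \<longleftrightarrow> (\<forall>c\<in>insert \<rho> (c ` C). sat I n c)"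
      using Q_Us_conj_of_set by blast
    show ?case
    proof (intro bexI[OF _ q(1)] conjI ballI impI)
      show "satP (last r) q" using c \<rho>(2) by (auto simp: satP_def q(2))
      fix r' assume r': "r' \<in> runs N" "length r' = length r" "satN (last r') q"
      have sat': "satN (last r') \<rho>" "\<And>s. s \<in> C \<Longrightarrow> satN (last r') (c s)"
        using r'(3) by (auto simp: satN_def q(2))
      have "\<exists>w h. ext s r' w h" if "s \<in> C" for s
        using c[OF that] r'(1,2) sat'(2)[OF that] by blast
      then obtain w h where "\<And>s. s \<in> C \<Longrightarrow> ext s r' (w s) (h s)" by metis
      then have wh: "\<And>s. s \<in> C \<Longrightarrow> (last r', w s) \<in> ts_trans N"
          "\<And>s. s \<in> C \<Longrightarrow> w s \<in> ts_states N"
          "\<And>s. s \<in> C \<Longrightarrow> ts_tlabel P (last r) s \<subseteq> ts_tlabel N (last r') (w s)"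
          "\<And>s. s \<in> C \<Longrightarrow> tree_hom P {t \<in> T. prefix (r @ [s]) t} N (h s)"
          "\<And>s. s \<in> C \<Longrightarrow> h s (r @ [s]) = r' @ [w s]"
        unfolding ext_def by blast+
      \<comment> \<open>The entry of \<open>t\<close> at position \<open>length r\<close> names the
        child of \<open>r\<close> above \<open>t\<close> and so selects which of the chosen
        homomorphisms to apply.\<close>
      define g where "g t = (if t = r then r' else h (t ! length r) t)" for t
      have child: "t ! length r \<in> C" "prefix (r @ [t ! length r]) t" if "t \<in> T" "prefix r t" "t \<noteq> r" for t
      proof -
        show "prefix (r @ [t ! length r]) t" by (rule prefix_snoc_cases[OF that(2,3)])
        then show "t ! length r \<in> C" using closed that(1) by (auto simp: C_def)
      qed
      have "tree_hom P {t \<in> T. prefix r t} N g"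
        unfolding tree_hom_def
      proof (intro conjI ballI impI)
        show "g \<in> {t \<in> T. prefix r t} \<rightarrow> runs N"
        proof
          fix t assume t: "t \<in> {t \<in> T. prefix r t}"
          show "g t \<in> runs N"
          proof (cases "t = r")
            case False
            then show ?thesis using wh(4)[of "t ! length r"] child[of t] t
              by (auto simp: g_def tree_hom_def)
          qed (simp add: g_def r'(1))
        qed
        show "g t \<in> tree_roots N" if "t \<in> {t \<in> T. prefix r t} \<inter> tree_roots P" for t
        proof -
          have "prefix r t" "length t = 1" using that by (auto simp: tree_roots_def)
          \<comment> \<open>A root of the computation tree can occur below \<open>r\<close> only as
            \<open>r\<close> itself; then \<open>r'\<close> also has length 1, which is why equal
            lengths are demanded.\<close>
          then have "t = r" using r(2) prefix_length_le[of r t] by (cases r) (auto simp: prefix_def)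
          then show ?thesis using r'(1,2) \<open>length t = 1\<close> by (simp add: g_def tree_roots_def)
        qed
        show "node_label P t \<subseteq> node_label N (g t)" if t: "t \<in> {t \<in> T. prefix r t}" for t
        proof (cases "t = r")
          case True
          then show ?thesis using \<rho>(3)[OF runs_last[OF r'(1)] sat'(1)]
            by (simp add: g_def node_label_def)
        next
          case False
          with t have "node_label P t \<subseteq> node_label N (h (t ! length r) t)"
            using child[of t] by (intro tree_homD(2)[OF wh(4)]) auto
          then show ?thesis using False by (simp add: g_def)
        qed
        fix t u assume t: "t \<in> {t \<in> T. prefix r t}" and u: "u \<in> {t \<in> T. prefix r t}"
          and e: "(t, u) \<in> tree_edges P"
        obtain s where s: "u = t @ [s]" using e by (auto simp: tree_edges_def)
        have "(g t, g u) \<in> tree_edges N \<and> edge_label P t u \<subseteq> edge_label N (g t) (g u)"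
        \<comment> \<open>An edge leaving \<open>r\<close> is sent to the chosen step from
          \<open>r'\<close> to \<open>w s\<close>. Every other edge stays within the subtree of a
          single child, because extending \<open>t\<close> does not change its entry at position
          \<open>length r\<close>.\<close>
        proof (cases "t = r")
          case True
          then have "s \<in> C" "u \<noteq> r" using u s by (auto simp: C_def)
          then have "g t = r'" "g u = r' @ [w s]" using True s wh(5) by (auto simp: g_def)
          moreover have "r' @ [w s] \<in> runs N" using runs_snoc[OF r'(1)] wh(1,2) \<open>s \<in> C\<close> by blast
          ultimately show ?thesis using True s wh(3)[OF \<open>s \<in> C\<close>] r'(1)
            by (auto simp: tree_edges_def edge_label_def simp del: split_paired_Ex)
        next
          case False
          let ?s = "t ! length r"
          have pre: "prefix (r @ [?s]) t" "?s \<in> C" using child t False by auto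
          then have "length r < length t" using prefix_length_le[OF pre(1)] by simp
          then have "u ! length r = ?s" "u \<noteq> r" using s by (auto simp: nth_append)
          then have "g t = h ?s t" "g u = h ?s u" using False by (auto simp: g_def)
          moreover have "prefix (r @ [?s]) u" using pre(1) s by auto
          ultimately show ?thesis using tree_homD(3,4)[OF wh(4)[OF pre(2)], of t u] pre(1) t u e by simp
        qed
        then show "(g t, g u) \<in> tree_edges N" "edge_label P t u \<subseteq> edge_label N (g t) (g u)"
          by auto
      qed
      then show "\<exists>h. tree_hom P {t \<in> T. prefix r t} N h \<and> h r = r'"
        by (intro exI[of _ g]) (simp add: g_def)
    qed
  qed
qed

end

section \<open>Paths\<close>

text \<open>Runs without the start condition: tails of runs are again paths, so inductions can
  remove the first state.\<close>

definition path :: "('s, 'a) tsys \<Rightarrow> 's list \<Rightarrow> bool" where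
  "path X r \<longleftrightarrow> r \<noteq> [] \<and> set r \<subseteq> ts_states X \<and>
     (\<forall>k. Suc k < length r \<longrightarrow> (r ! k, r ! Suc k) \<in> ts_trans X)"

definition covers :: "('s, 'a) tsys \<Rightarrow> ('t, 'a) tsys \<Rightarrow> 's list \<Rightarrow> 't list \<Rightarrow> bool" where
  "covers X Y r r' \<longleftrightarrow> length r' = length r \<and>
     (\<forall>k<length r. ts_label X (r ! k) \<subseteq> ts_label Y (r' ! k)) \<and>
     (\<forall>k. Suc k < length r \<longrightarrow>
        ts_tlabel X (r ! k) (r ! Suc k) \<subseteq> ts_tlabel Y (r' ! k) (r' ! Suc k))"

lemma runs_iff_path: "r \<in> runs X \<longleftrightarrow> path X r \<and> hd r \<in> ts_start X"
  by (auto simp: runs_def path_def)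

lemma contained_iff_covers: "Defs.contained X Y \<longleftrightarrow> (\<forall>r\<in>runs X. \<exists>r'\<in>runs Y. covers X Y r r')"
  by (simp add: contained_def covers_def)

section \<open>Recursive descriptions of paths and coverings\<close>

lemma all_nat_split: "(\<forall>k. Q k) \<longleftrightarrow> Q 0 \<and> (\<forall>k. Q (Suc k))"
  by (metis not0_implies_Suc)

lemma path_single: "path X [x] \<longleftrightarrow> x \<in> ts_states X"
  by (simp add: path_def)

lemma path_Cons_Cons:
  "path X (x # y # r) \<longleftrightarrow> x \<in> ts_states X \<and> (x, y) \<in> ts_trans X \<and> path X (y # r)"
proof -
  have "(\<forall>k. Suc k < length (x # y # r) \<longrightarrow> ((x # y # r) ! k, (x # y # r) ! Suc k) \<in> ts_trans X)
    \<longleftrightarrow> (x, y) \<in> ts_trans X \<and>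
      (\<forall>k. Suc k < length (y # r) \<longrightarrow> ((y # r) ! k, (y # r) ! Suc k) \<in> ts_trans X)"
    by (subst all_nat_split) simp
  then show ?thesis unfolding path_def by auto
qed

lemma covers_single: "covers X Y [x] r' \<longleftrightarrow> (\<exists>z. r' = [z] \<and> ts_label X x \<subseteq> ts_label Y z)"
  by (auto simp: covers_def length_Suc_conv)

lemma covers_Cons_Cons:
  "covers X Y (x # y # r) r' \<longleftrightarrow> (\<exists>z w r''. r' = z # w # r'' \<and> ts_label X x \<subseteq> ts_label Y z \<and>
     ts_tlabel X x y \<subseteq> ts_tlabel Y z w \<and> covers X Y (y # r) (w # r''))"
proof (cases "\<exists>z w r''. r' = z # w # r''")
  case True
  then obtain z w r'' where r': "r' = z # w # r''" by blast
  have "(\<forall>k. Suc k < length (x # y # r) \<longrightarrow> ts_tlabel X ((x # y # r) ! k) ((x # y # r) ! Suc k)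
        \<subseteq> ts_tlabel Y ((z # w # r'') ! k) ((z # w # r'') ! Suc k))
    \<longleftrightarrow> ts_tlabel X x y \<subseteq> ts_tlabel Y z w \<and>
      (\<forall>k. Suc k < length (y # r) \<longrightarrow> ts_tlabel X ((y # r) ! k) ((y # r) ! Suc k)
        \<subseteq> ts_tlabel Y ((w # r'') ! k) ((w # r'') ! Suc k))"
    by (subst all_nat_split) simp
  moreover have "(\<forall>k<length (x # y # r). ts_label X ((x # y # r) ! k) \<subseteq> ts_label Y ((z # w # r'') ! k))
    \<longleftrightarrow> ts_label X x \<subseteq> ts_label Y z \<and>
      (\<forall>k<length (y # r). ts_label X ((y # r) ! k) \<subseteq> ts_label Y ((w # r'') ! k))"
    by (subst all_nat_split) simp
  ultimately show ?thesis unfolding covers_def r' by auto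
next
  case False
  then have "length r' \<noteq> length (x # y # r)" by (auto simp: length_Suc_conv)
  with False show ?thesis by (auto simp: covers_def)
qed

context examples
begin

text \<open>A query in \<open>Q_p\<close> has at most one \<open>Until\<close> conjunct at each
  level, so advancing the witnesses never branches and produces a path.\<close>

lemma path_of_query:
  assumes "q \<in> Q_p" "s \<in> ts_states P" "satP s q"
  shows "\<exists>r. path P (s # r) \<and> (\<forall>r'. path N r' \<longrightarrow> covers P N (s # r) r' \<longrightarrow> satN (hd r') q)"
  using assms
proof (induction arbitrary: s)
  case (1 \<rho>)
  have "satN z \<rho>" if "path N [z]" "ts_label P s \<subseteq> ts_label N z" for z
    using label_transfer[OF atom_conjs_no_until[OF 1(1)] 1(3)] that unfolding path_single by blast
  then show ?case using 1(2) by (intro exI[of _ "[]"]) (auto simp: path_single covers_single)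
next
  case (2 \<rho> lam q)
  have sat: "satP s \<rho>" "satP s (Until lam q)" using "2.prems"(2) by (auto simp: satP_def)
  have "\<not> until_occurs lam" using 2(2) atom_conjs_no_until by auto
  then obtain p where p: "(s, p) \<in> ts_trans P" "satP p q"
    "\<And>z w q'. (z, w) \<in> ts_trans N \<Longrightarrow> ts_tlabel P s p \<subseteq> ts_tlabel N z w \<Longrightarrow> satN w q'
       \<Longrightarrow> satN z (Until lam q')"
    using until_advance[OF "2.prems"(1) sat(2)] by blast
  have "p \<in> ts_states P" using p(1) unfolding ts_product_simps by blast
  then obtain r where r: "path P (p # r)"
      "\<And>r'. path N r' \<Longrightarrow> covers P N (p # r) r' \<Longrightarrow> satN (hd r') q"
    using "2.IH" p(2) by blast
  have "satN (hd r') (And \<rho> (Until lam q))" if r': "path N r'" "covers P N (s # p # r) r'" for r'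
  proof -
    obtain z w r'' where z: "r' = z # w # r''" "ts_label P s \<subseteq> ts_label N z"
        "ts_tlabel P s p \<subseteq> ts_tlabel N z w" "covers P N (p # r) (w # r'')"
      using r'(2) unfolding covers_Cons_Cons by blast
    then have w: "z \<in> ts_states N" "(z, w) \<in> ts_trans N" "path N (w # r'')"
      using r'(1) by (simp_all only: path_Cons_Cons)
    have "satN w q" using r(2)[OF w(3) z(4)] by simp
    then have "satN z (Until lam q)" by (rule p(3)[OF w(2) z(3)])
    moreover have "satN z \<rho>" by (rule label_transfer[OF atom_conjs_no_until[OF 2(1)] sat(1) w(1) z(2)])
    ultimately show ?thesis by (simp add: satN_def z(1))
  qed
  moreover have "path P (s # p # r)" using "2.prems"(1) p(1) r(1) by (simp only: path_Cons_Cons)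
  ultimately show ?case by (intro exI[of _ "p # r"]) blast
qed

text \<open>The path is read backwards: each state contributes a conjunction of atoms and each
  transition an \<open>Until\<close>. Satisfying the query at \<open>z\<close> then supplies
  successors in \<open>N\<close> one after another.\<close>

lemma query_of_path:
  assumes "path P (s # r)"
  shows "\<exists>q\<in>Q_p. satP s q \<and>
    (\<forall>z\<in>ts_states N. satN z q \<longrightarrow> (\<exists>r'. path N (z # r') \<and> covers P N (s # r) (z # r')))"
  using assms
proof (induction r arbitrary: s)
  case Nil
  obtain \<rho> where "\<rho> \<in> atom_conjs" "satP s \<rho>"
      "\<And>z. z \<in> ts_states N \<Longrightarrow> satN z \<rho> \<Longrightarrow> ts_label P s \<subseteq> ts_label N z"
    using label_query by blast
  then show ?case
    by (intro bexI[of _ \<rho>] conjI ballI impI exI[of _ "[]"])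
      (auto simp: path_single covers_single intro: Q_p.intros)
next
  case (Cons p r)
  then have s: "s \<in> ts_states P" "(s, p) \<in> ts_trans P" "path P (p # r)"
    by (simp_all only: path_Cons_Cons)
  obtain q where q: "q \<in> Q_p" "satP p q" "\<And>z. z \<in> ts_states N \<Longrightarrow> satN z q \<Longrightarrow>
      \<exists>r'. path N (z # r') \<and> covers P N (p # r) (z # r')"
    using Cons.IH[OF s(3)] by blast
  obtain \<rho> where \<rho>: "\<rho> \<in> atom_conjs" "satP s \<rho>"
      "\<And>z. z \<in> ts_states N \<Longrightarrow> satN z \<rho> \<Longrightarrow> ts_label P s \<subseteq> ts_label N z"
    using label_query by blast
  obtain lam where lam: "lam \<in> atom_conjs \<union> {Bot}" "\<And>q. satP p q \<Longrightarrow> satP s (Until lam q)"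
      "\<And>z q. z \<in> ts_states N \<Longrightarrow> satN z (Until lam q) \<Longrightarrow>
         \<exists>w. w \<in> ts_states N \<and> (z, w) \<in> ts_trans N \<and> ts_tlabel P s p \<subseteq> ts_tlabel N z w \<and> satN w q"
    using until_query[OF s(2)] by blast
  show ?case
  proof (intro bexI[of _ "And \<rho> (Until lam q)"] conjI ballI impI)
    show "And \<rho> (Until lam q) \<in> Q_p" by (rule Q_p.intros(2)[OF \<rho>(1) lam(1) q(1)])
    show "satP s (And \<rho> (Until lam q))"
      using \<rho>(2) lam(2)[OF q(2)] by (auto simp: satP_def)
    fix z assume z: "z \<in> ts_states N" "satN z (And \<rho> (Until lam q))"
    then have sat: "satN z \<rho>" "satN z (Until lam q)" by (simp_all add: satN_def)
    obtain w where w: "w \<in> ts_states N" "(z, w) \<in> ts_trans N"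
        "ts_tlabel P s p \<subseteq> ts_tlabel N z w" "satN w q"
      using lam(3)[OF z(1) sat(2)] by blast
    obtain r' where r': "path N (w # r')" "covers P N (p # r) (w # r')" using q(3)[OF w(1,4)] by blast
    have "path N (z # w # r')" using z(1) w(2) r'(1) by (simp only: path_Cons_Cons)
    moreover have "covers P N (s # p # r) (z # w # r')"
      using \<rho>(3)[OF z(1) sat(1)] w(3) r'(2) unfolding covers_Cons_Cons by blast
    ultimately show "\<exists>r'. path N (z # r') \<and> covers P N (s # p # r) (z # r')" by blast
  qed
qed

section \<open>Separability\<close>

text \<open>The restriction is required because product states are extensional functions on
  \<open>Ipos\<close>.\<close>

definition origin :: "'i \<Rightarrow> nat" where
  "origin = restrict (\<lambda>_. 0) Ipos"

lemma start_P: "ts_start P = {origin}"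
  by (auto simp: origin_def ts_product_simps data_ts_simps)

lemma start_subset_states: "ts_start P \<subseteq> ts_states P" "ts_start N \<subseteq> ts_states N"
  by (auto simp: ts_product_simps ts_union_simps data_ts_simps)

text \<open>Entailment reduces to truth at time 0 of the least models; \<open>origin\<close> gathers
  these points for the positive examples, and the start states of \<open>N\<close> are those of the
  negative ones.\<close>

lemma separable_iff:
  "separable Q (\<D> ` Ipos) (\<D> ` Ineg) \<longleftrightarrow> (\<exists>q\<in>Q. satP origin q \<and> (\<forall>z\<in>ts_start N. \<not> satN z q))"
  by (simp add: separable_def entails0_iff_least_model satP_def satN_def origin_def
      ts_union_simps data_ts_simps)

lemma separable_Q_Us_iff: "\<not> separable Q_Us (\<D> ` Ipos) (\<D> ` Ineg) \<longleftrightarrow> simulated P N"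
proof
  have origin_run: "[origin] \<in> runs P"
    using start_P start_subset_states by (auto simp: runs_def)
  show "\<not> separable Q_Us (\<D> ` Ipos) (\<D> ` Ineg)" if sim: "simulated P N"
  proof
    assume "separable Q_Us (\<D> ` Ipos) (\<D> ` Ineg)"
    then obtain q where q: "q \<in> Q_Us" "satP origin q" "\<forall>z\<in>ts_start N. \<not> satN z q"
      unfolding separable_iff by blast
    have "satP (last [origin]) q" using q(2) by simp
    then obtain T where T: "finite T" "T \<subseteq> runs P" "[origin] \<in> T" "\<forall>t\<in>T. prefix [origin] t"
        "\<forall>t\<in>T. \<forall>p. prefix [origin] p \<and> prefix p t \<longrightarrow> p \<in> T"
        "\<forall>h. tree_hom P T N h \<longrightarrow> satN (last (h [origin])) q"
      using tree_of_query[OF q(1) origin_run] by blast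
    have root: "[origin] \<in> T \<inter> tree_roots P" using T(3) origin_run by (simp add: tree_roots_def)
    have "finite_subtree P T"
      unfolding finite_subtree_def
    proof (intro conjI ballI allI impI)
      show "\<exists>!r. r \<in> T \<inter> tree_roots P"
      proof (rule ex1I[of _ "[origin]"])
        show "[origin] \<in> T \<inter> tree_roots P" by (rule root)
        fix r assume "r \<in> T \<inter> tree_roots P"
        then have "prefix [origin] r" "length r = 1" using T(4) by (auto simp: tree_roots_def)
        then show "r = [origin]" by (auto simp: prefix_def)
      qed
      fix t p assume t: "t \<in> T" and p: "p \<noteq> [] \<and> prefix p t"
      \<comment> \<open>\<open>T\<close> is only known to contain the prefixes that extend its root;
        a nonempty prefix starts with the same state as \<open>t\<close>, so it is one of
        these.\<close>
      then have "prefix [origin] p" using T(4) by (cases p; cases t) auto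
      then show "p \<in> T" using T(5) t p by blast
    qed (use T in auto)
    then obtain h where h: "tree_hom P T N h" using sim unfolding simulated_def by blast
    then have "h [origin] \<in> tree_roots N" using root unfolding tree_hom_def by blast
    \<comment> \<open>The image of the root is a root, hence a list consisting of one start state,
      and there \<open>q\<close> is forced although it fails in every negative example.\<close>
    then have "last (h [origin]) \<in> ts_start N"
      by (auto simp: tree_roots_def runs_def length_Suc_conv)
    then show False using q(3) T(6) h by blast
  qed
  show "simulated P N" if nsep: "\<not> separable Q_Us (\<D> ` Ipos) (\<D> ` Ineg)"
    unfolding simulated_def
  proof (intro allI impI)
    fix T assume T: "finite_subtree P T"
    \<comment> \<open>The product has a single start state, so the description of the subtree below
      \<open>[origin]\<close> covers all of \<open>T\<close>.\<close>
    have pre: "prefix [origin] t" if "t \<in> T" for t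
    proof -
      have "t \<noteq> []" "hd t = origin" using that T start_P by (auto simp: finite_subtree_def runs_def)
      then show ?thesis by (cases t) auto
    qed
    obtain r where "r \<in> T" "length r = 1" using T by (auto simp: finite_subtree_def tree_roots_def)
    with pre[of r] have origin: "[origin] \<in> T" by (auto simp: prefix_def)
    have tree: "finite T" "T \<subseteq> runs P" "\<forall>t\<in>T. \<forall>p. p \<noteq> [] \<and> prefix p t \<longrightarrow> p \<in> T"
      using T by (simp_all add: finite_subtree_def)
    obtain q where q: "q \<in> Q_Us" "satP (last [origin]) q"
        "\<forall>r'\<in>runs N. length r' = length [origin] \<longrightarrow> satN (last r') q \<longrightarrow>
          (\<exists>h. tree_hom P {t \<in> T. prefix [origin] t} N h \<and> h [origin] = r')"
      using query_of_tree[OF tree origin] by (elim bexE conjE) rule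
    obtain z where z: "z \<in> ts_start N" "satN z q" using nsep q(1,2) unfolding separable_iff last.simps by auto
    have "[z] \<in> runs N" using z(1) start_subset_states(2) by (auto simp: runs_def)
    moreover have "{t \<in> T. prefix [origin] t} = T" using pre by blast
    ultimately show "\<exists>h. tree_hom P T N h" using q(3) z(2) by fastforce
  qed
qed

lemma separable_Q_p_iff: "\<not> separable Q_p (\<D> ` Ipos) (\<D> ` Ineg) \<longleftrightarrow> Defs.contained P N"
proof
  show "\<not> separable Q_p (\<D> ` Ipos) (\<D> ` Ineg)" if cont: "Defs.contained P N"
  proof
    assume "separable Q_p (\<D> ` Ipos) (\<D> ` Ineg)"
    then obtain q where q: "q \<in> Q_p" "satP origin q" "\<forall>z\<in>ts_start N. \<not> satN z q"
      unfolding separable_iff by blast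
    then obtain r where r: "path P (origin # r)"
        "\<And>r'. path N r' \<Longrightarrow> covers P N (origin # r) r' \<Longrightarrow> satN (hd r') q"
      using path_of_query[OF q(1) _ q(2)] start_P start_subset_states(1) by blast
    then have "origin # r \<in> runs P" using start_P by (simp add: runs_iff_path)
    then obtain r' where "r' \<in> runs N" "covers P N (origin # r) r'"
      using cont unfolding contained_iff_covers by blast
    then show False using r(2) q(3) unfolding runs_iff_path by blast
  qed
  show "Defs.contained P N" if nsep: "\<not> separable Q_p (\<D> ` Ipos) (\<D> ` Ineg)"
    unfolding contained_iff_covers
  proof
    fix r assume "r \<in> runs P"
    then obtain u where r: "r = origin # u" "path P (origin # u)"
      using runs_nonempty start_P by (cases r) (auto simp: runs_iff_path)
    obtain q where q: "q \<in> Q_p" "satP origin q" "\<And>z. z \<in> ts_states N \<Longrightarrow> satN z q \<Longrightarrow>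
        \<exists>r'. path N (z # r') \<and> covers P N (origin # u) (z # r')"
      using query_of_path[OF r(2)] by blast
    obtain z where z: "z \<in> ts_start N" "satN z q" using nsep q(1,2) unfolding separable_iff by blast
    then obtain r' where "path N (z # r')" "covers P N r (z # r')"
      using q(3) start_subset_states(2) r(1) by blast
    then show "\<exists>r'\<in>runs N. covers P N r r'"
      using z(1) by (intro bexI[of _ "z # r'"]) (simp_all add: runs_iff_path)
  qed
qed

end

theorem theorem3:
  fixes \<D> :: "nat \<Rightarrow> 'a data" and l :: nat and Ipos Ineg :: "nat set"
    and Epos Eneg :: "'a data set" and \<Sigma> :: "'a set"
    and P :: "(nat \<Rightarrow> nat, 'a) tsys" and N :: "(nat \<times> nat, 'a) tsys"
  assumes "l \<ge> 1" and "Ipos = {1..l}" and "Ipos \<inter> Ineg = {}"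
    and "\<And>i. i \<in> Ipos \<union> Ineg \<Longrightarrow> finite (\<D> i)"
    and "Epos = \<D> ` Ipos" and "Eneg = \<D> ` Ineg"
    and "\<Sigma> = atoms_of (Epos \<union> Eneg)"
    and "P = ts_product Ipos (\<lambda>i. data_ts \<Sigma> (\<D> i))"
    and "N = ts_union Ineg (\<lambda>i. data_ts \<Sigma> (\<D> i))"
  shows "(\<not> separable Q_Us Epos Eneg \<longleftrightarrow> simulated P N) \<and>
         (\<not> separable Q_p Epos Eneg \<longleftrightarrow> contained P N)"
proof -
  \<comment> \<open>The bound \<open>l \<ge> 1\<close> makes \<open>Ipos\<close> nonempty, and
    \<open>\<Sigma>\<close> contains the atoms of the positive examples by its definition.\<close>
  interpret examples \<D> Ipos Ineg \<Sigma>
    using assms by unfold_locales (auto simp: atoms_of_def)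
  show ?thesis
    using separable_Q_Us_iff separable_Q_p_iff unfolding assms(5,6,8,9) by blast
qed

end
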